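(* Let $\mathbf{V}$ be an e-variety of regular semigroups and let $S\in\mathcal{IC}$ be an idempotent covered semigroup. Then $S\in\mathbf{LV}$ if and only if $T(S)\in\mathbf{LV}$.
   Context: An e-variety of regular semigroups is a class of regular semigroups closed under homomorphic images, regular subsemigroups and direct products. For an e-variety $\mathbf{V}$, $\mathbf{LV}$ is the class of all regular semigroups $A$ whose local submonoids $eAe$ ($e$ an idempotent of $A$) all belong to $\mathbf{V}$. For a semigroup $S$, $E(S)$ denotes its set of idempotents, and $S^1$ denotes $S$ itself if $S$ is a monoid, and otherwise $S$ with an identity $1$ adjoined. $S$ is idempotent covered ($S\in\mathcal{IC}$) if for every $s\in S$ there are $e,f\in E(S)$ with $se=s=fs$. Let $R_2=\{\sigma,\tau\}$ be the two-element right-zero semigroup, and let $T*R_2$ be the set $S\times S\times R_2$ with product $(t_1,s_1,\sigma)(t_2,s_2,\alpha_2)=(t_1s_2,\,s_1s_2,\,\alpha_2)$ and $(t_1,s_1,\tau)(t_2,s_2,\alpha_2)=(t_1t_2,\,s_1t_2,\,\alpha_2)$ (a semidirect product of $T=S\times S$ by $R_2$). Let $E=\{(s,t,\alpha)\in E(T*R_2):\ s\in S^1t\}$ and $T(S)=\langle E\rangle$, the subsemigroup generated by $E$; for $S\in\mathcal{IC}$ one has $T(S)=\{(s,t,\alpha)\in T*R_2: s\in S^1t\}$. *)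

theory Defs
  imports "HOL-Algebra.Congruence" "HOL-Library.FuncSet" "HOL-Library.Infinite_Typeclass"
begin

section \<open>Semigroups\<close>

record 'a sgp = "'a partial_object" +
  mul :: "'a \<Rightarrow> 'a \<Rightarrow> 'a" (infixl "\<cdot>\<index>" 70)

locale sgp =
  fixes S :: "('a, 'm) sgp_scheme" (structure)
  assumes nonempty: "carrier S \<noteq> {}"
    and closed: "x \<in> carrier S \<Longrightarrow> y \<in> carrier S \<Longrightarrow> x \<cdot> y \<in> carrier S"
    and assoc: "x \<in> carrier S \<Longrightarrow> y \<in> carrier S \<Longrightarrow> z \<in> carrier S
      \<Longrightarrow> (x \<cdot> y) \<cdot> z = x \<cdot> (y \<cdot> z)"

locale regular_sgp = sgp +
  assumes regular: "x \<in> carrier S \<Longrightarrow> \<exists>y \<in> carrier S. x \<cdot> y \<cdot> x = x"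

definition subsgp :: "'a set \<Rightarrow> 'a sgp \<Rightarrow> bool" where
  "subsgp B S \<longleftrightarrow> B \<noteq> {} \<and> B \<subseteq> carrier S \<and> (\<forall>x\<in>B. \<forall>y\<in>B. x \<cdot>\<^bsub>S\<^esub> y \<in> B)"

definition sgp_hom :: "'a sgp \<Rightarrow> 'b sgp \<Rightarrow> ('a \<Rightarrow> 'b) set" where
  "sgp_hom A B = {h. h \<in> carrier A \<rightarrow> carrier B \<and>
     (\<forall>x\<in>carrier A. \<forall>y\<in>carrier A. h (x \<cdot>\<^bsub>A\<^esub> y) = h x \<cdot>\<^bsub>B\<^esub> h y)}"

definition sgp_isomorphic :: "'a sgp \<Rightarrow> 'b sgp \<Rightarrow> bool" where
  "sgp_isomorphic A B \<longleftrightarrow> (\<exists>h \<in> sgp_hom A B. bij_betw h (carrier A) (carrier B))"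

definition sgp_prod :: "'i set \<Rightarrow> ('i \<Rightarrow> 'a sgp) \<Rightarrow> ('i \<Rightarrow> 'a) sgp" where
  "sgp_prod I F = \<lparr>carrier = (\<Pi>\<^sub>E i\<in>I. carrier (F i)),
                   mul = (\<lambda>x y. \<lambda>i\<in>I. x i \<cdot>\<^bsub>F i\<^esub> y i)\<rparr>"

inductive_set sgp_gen :: "'a sgp \<Rightarrow> 'a set \<Rightarrow> 'a set" for S X where
  base: "x \<in> X \<Longrightarrow> x \<in> sgp_gen S X"
| mult: "x \<in> sgp_gen S X \<Longrightarrow> y \<in> sgp_gen S X \<Longrightarrow> x \<cdot>\<^bsub>S\<^esub> y \<in> sgp_gen S X"

definition idem :: "'a sgp \<Rightarrow> 'a set" where
  "idem S = {e \<in> carrier S. e \<cdot>\<^bsub>S\<^esub> e = e}"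

definition local_submonoid :: "'a sgp \<Rightarrow> 'a \<Rightarrow> 'a sgp" where
  "local_submonoid S e = S\<lparr>carrier := {e \<cdot>\<^bsub>S\<^esub> a \<cdot>\<^bsub>S\<^esub> e | a. a \<in> carrier S}\<rparr>"

definition idempotent_covered :: "'a sgp \<Rightarrow> bool" where
  "idempotent_covered S \<longleftrightarrow> sgp S \<and>
     (\<forall>s \<in> carrier S. \<exists>e \<in> idem S. \<exists>f \<in> idem S. s \<cdot>\<^bsub>S\<^esub> e = s \<and> f \<cdot>\<^bsub>S\<^esub> s = s)"

definition is_monoid :: "'a sgp \<Rightarrow> bool" where
  "is_monoid S \<longleftrightarrow> (\<exists>u \<in> carrier S. \<forall>x \<in> carrier S. u \<cdot>\<^bsub>S\<^esub> x = x \<and> x \<cdot>\<^bsub>S\<^esub> u = x)"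

text \<open>
  \<open>S\<^sup>1\<close>: the element \<open>s\<close> of \<open>S\<close> is represented by \<open>Some s\<close>. The new identity \<open>None\<close> is an element
  only if \<open>S\<close> has no identity already.
\<close>

definition adjoin_one :: "'a sgp \<Rightarrow> 'a option sgp" where
  "adjoin_one S =
    \<lparr>carrier = (if is_monoid S then Some ` carrier S else insert None (Some ` carrier S)),
     mul = (\<lambda>x y. case x of None \<Rightarrow> y
              | Some a \<Rightarrow> (case y of None \<Rightarrow> Some a | Some b \<Rightarrow> Some (a \<cdot>\<^bsub>S\<^esub> b)))\<rparr>"

definition left_multiples1 :: "'a sgp \<Rightarrow> 'a \<Rightarrow> 'a set" where
  "left_multiples1 S t =
     {s \<in> carrier S. \<exists>x \<in> carrier (adjoin_one S). Some s = x \<cdot>\<^bsub>adjoin_one S\<^esub> Some t}"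

section \<open>Existence varieties\<close>

text \<open>
  A class of semigroups is represented by a set of semigroups whose carriers are subsets of a
  fixed but arbitrary infinite type \<open>'u\<close>, i.e. up to isomorphism by its members of cardinality
  at most \<open>|'u|\<close>.

  A direct product of semigroups over \<open>'u\<close> need not have a copy over \<open>'u\<close>, so closure under direct
  products is stated through the regular subsemigroups of the product that do have one. If the
  product itself has such a copy, the clause puts it into \<open>V\<close>. For genuine (unbounded) classes
  the clause is closure under direct products followed by closure under regular subsemigroups.
  Index sets in \<open>'u\<close> suffice: at most \<open>|'u|\<close> coordinates are needed to separate the points
  of a subsemigroup of cardinality at most \<open>|'u|\<close>. Consequently the sets \<open>V\<close> below are exactly the
  restrictions to \<open>'u\<close> of e-varieties; mere closure under those products that fit into \<open>'u\<close>
  would not be enough for this (over \<open>nat\<close> it holds for the finite regular semigroups).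

  The empty index set is allowed, so every e-variety contains the trivial semigroups.
\<close>

definition e_variety :: "('u::infinite) sgp set \<Rightarrow> bool" where
  "e_variety V \<longleftrightarrow>
     (\<forall>A \<in> V. regular_sgp A) \<and>
     (\<forall>A \<in> V. \<forall>B :: 'u sgp. \<forall>h.
        sgp B \<and> h \<in> sgp_hom A B \<and> h ` carrier A = carrier B \<longrightarrow> B \<in> V) \<and>
     (\<forall>A \<in> V. \<forall>B. subsgp B A \<and> regular_sgp (A\<lparr>carrier := B\<rparr>) \<longrightarrow> A\<lparr>carrier := B\<rparr> \<in> V) \<and>
     (\<forall>(I :: 'u set) F. \<forall>A :: 'u sgp. \<forall>h.
        (\<forall>i \<in> I. F i \<in> V) \<and> regular_sgp A \<and>
        h \<in> sgp_hom A (sgp_prod I F) \<and> inj_on h (carrier A) \<longrightarrow> A \<in> V)"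

text \<open>Membership of a semigroup over any type in the class represented by \<open>V\<close>.\<close>

definition in_class :: "'a sgp \<Rightarrow> ('u::infinite) sgp set \<Rightarrow> bool" where
  "in_class A V \<longleftrightarrow> (\<exists>B \<in> V. sgp_isomorphic A B)"

definition LV :: "('u::infinite) sgp set \<Rightarrow> 'a sgp set" where
  "LV V = {A. regular_sgp A \<and> (\<forall>e \<in> idem A. in_class (local_submonoid A e) V)}"

section \<open>The semigroup \<open>T(S)\<close>\<close>

datatype R2 = R2_sigma | R2_tau

fun T_star_R2_mul :: "'a sgp \<Rightarrow> 'a \<times> 'a \<times> R2 \<Rightarrow> 'a \<times> 'a \<times> R2 \<Rightarrow> 'a \<times> 'a \<times> R2" where
  "T_star_R2_mul S (t1, s1, R2_sigma) (t2, s2, a2) = (t1 \<cdot>\<^bsub>S\<^esub> s2, s1 \<cdot>\<^bsub>S\<^esub> s2, a2)"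
| "T_star_R2_mul S (t1, s1, R2_tau) (t2, s2, a2) = (t1 \<cdot>\<^bsub>S\<^esub> t2, s1 \<cdot>\<^bsub>S\<^esub> t2, a2)"

definition T_star_R2 :: "'a sgp \<Rightarrow> ('a \<times> 'a \<times> R2) sgp" where
  "T_star_R2 S = \<lparr>carrier = carrier S \<times> carrier S \<times> UNIV, mul = T_star_R2_mul S\<rparr>"

definition T_idems :: "'a sgp \<Rightarrow> ('a \<times> 'a \<times> R2) set" where
  "T_idems S = {(s, t, a) | s t a. (s, t, a) \<in> idem (T_star_R2 S) \<and> s \<in> left_multiples1 S t}"

definition T_sgp :: "'a sgp \<Rightarrow> ('a \<times> 'a \<times> R2) sgp" where
  "T_sgp S = (T_star_R2 S)\<lparr>carrier := sgp_gen (T_star_R2 S) (T_idems S)\<rparr>"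

end

theory Submission
  imports Defs
begin

text \<open>
  The local submonoids of \<open>T(S)\<close> are, up to isomorphism, exactly those of \<open>S\<close>. In \<open>T * R\<^sub>2\<close>
  a right factor \<open>x\<close> acts on \<open>(s, t, \<alpha>)\<close> through a single element of \<open>S\<close>: with \<open>entry \<alpha> x\<close> denoting the
  second component of \<open>x\<close> for \<open>\<alpha> = \<sigma>\<close> and the first for \<open>\<alpha> = \<tau>\<close>, one has
  \<open>(s, t, \<alpha>) x = (s \<cdot> entry \<alpha> x, t \<cdot> entry \<alpha> x, \<beta>)\<close>, where \<open>\<beta>\<close> is the last component of \<open>x\<close>. If
  \<open>g = (s, t, \<alpha>)\<close> is idempotent, then \<open>e = entry \<alpha> g\<close> is an idempotent of \<open>S\<close> with \<open>s e = s\<close> and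
  \<open>t e = t\<close>, and \<open>u \<mapsto> (s u, t u, \<alpha>)\<close> maps \<open>e S e\<close> isomorphically onto the local submonoid of \<open>T(S)\<close>
  at \<open>g\<close> (lemma \<open>local_submonoid_T_isomorphic\<close>). Every idempotent \<open>e\<close> of \<open>S\<close> arises in this way,
  from \<open>(e, e, \<sigma>)\<close>.

  What remains is that \<open>T(S)\<close> is regular if and only if \<open>S\<close> is. For this, and to
  see that the map above takes its values in \<open>T(S)\<close>, one has to know the elements of \<open>T(S)\<close> and not just its generators: idempotent covers make
  every triple \<open>(s, t, \<alpha>)\<close> with \<open>s \<in> S t\<close> a product of generators (lemma \<open>carrier_T\<close>).
\<close>

section \<open>Isomorphic semigroups\<close>

lemma sgp_isomorphic_sym:
  assumes iso: "sgp_isomorphic A B"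
    and closed: "\<And>x y. x \<in> carrier A \<Longrightarrow> y \<in> carrier A \<Longrightarrow> x \<cdot>\<^bsub>A\<^esub> y \<in> carrier A"
  shows "sgp_isomorphic B A"
proof -
  obtain h where hom: "h \<in> sgp_hom A B" and bij: "bij_betw h (carrier A) (carrier B)"
    using iso unfolding sgp_isomorphic_def by blast
  let ?k = "inv_into (carrier A) h"
  have k: "?k y \<in> carrier A" "h (?k y) = y" if "y \<in> carrier B" for y
    using that bij by (auto simp: bij_betw_def inv_into_into f_inv_into_f)
  have "?k (x \<cdot>\<^bsub>B\<^esub> y) = ?k x \<cdot>\<^bsub>A\<^esub> ?k y" if "x \<in> carrier B" "y \<in> carrier B" for x y
  proof -
    have "x \<cdot>\<^bsub>B\<^esub> y = h (?k x \<cdot>\<^bsub>A\<^esub> ?k y)"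
      using hom k that by (simp add: sgp_hom_def)
    then show ?thesis
      using bij closed k that by (simp add: bij_betw_def inv_into_f_f)
  qed
  with k have "?k \<in> sgp_hom B A"
    by (auto simp: sgp_hom_def)
  with bij_betw_inv_into[OF bij] show ?thesis
    unfolding sgp_isomorphic_def by blast
qed

lemma sgp_isomorphic_trans:
  assumes "sgp_isomorphic A B" and "sgp_isomorphic B C"
  shows "sgp_isomorphic A C"
proof -
  obtain h k where hk: "h \<in> sgp_hom A B" "bij_betw h (carrier A) (carrier B)"
      "k \<in> sgp_hom B C" "bij_betw k (carrier B) (carrier C)"
    using assms unfolding sgp_isomorphic_def by blast
  then have "k \<circ> h \<in> sgp_hom A C"
    by (auto simp: sgp_hom_def Pi_iff)
  with bij_betw_trans[OF hk(2) hk(4)] show ?thesis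
    unfolding sgp_isomorphic_def by blast
qed

lemma in_class_isomorphic:
  assumes "sgp_isomorphic A B"
    and "\<And>x y. x \<in> carrier A \<Longrightarrow> y \<in> carrier A \<Longrightarrow> x \<cdot>\<^bsub>A\<^esub> y \<in> carrier A"
  shows "in_class A V \<longleftrightarrow> in_class B V"
  using assms sgp_isomorphic_sym sgp_isomorphic_trans unfolding in_class_def by metis

section \<open>The product of \<open>T * R\<^sub>2\<close>\<close>

fun entry :: "R2 \<Rightarrow> 'a \<times> 'a \<times> R2 \<Rightarrow> 'a" where
  "entry R2_sigma (s, t, a) = t"
| "entry R2_tau (s, t, a) = s"

lemma mul_T_star_R2:
  "(s, t, a) \<cdot>\<^bsub>T_star_R2 S\<^esub> x = (s \<cdot>\<^bsub>S\<^esub> entry a x, t \<cdot>\<^bsub>S\<^esub> entry a x, snd (snd x))"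
  by (cases x; cases a) (simp_all add: T_star_R2_def)

lemma entry_mul:
  "entry b (s \<cdot>\<^bsub>S\<^esub> u, t \<cdot>\<^bsub>S\<^esub> u, c) = entry b (s, t, a) \<cdot>\<^bsub>S\<^esub> u"
  by (cases b) simp_all

lemma entry_in_carrier: "s \<in> carrier S \<Longrightarrow> t \<in> carrier S \<Longrightarrow> entry b (s, t, a) \<in> carrier S"
  by (cases b) simp_all

lemma mem_T_star_R2 [simp]: "(s, t, a) \<in> carrier (T_star_R2 S) \<longleftrightarrow> s \<in> carrier S \<and> t \<in> carrier S"
  by (simp add: T_star_R2_def)

lemma mul_T_sgp [simp]: "(\<cdot>\<^bsub>T_sgp S\<^esub>) = (\<cdot>\<^bsub>T_star_R2 S\<^esub>)"
  by (simp add: T_sgp_def)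

lemma T_star_R2_assoc:
  assumes "sgp S"
    and "x \<in> carrier (T_star_R2 S)" "y \<in> carrier (T_star_R2 S)" "z \<in> carrier (T_star_R2 S)"
  shows "(x \<cdot>\<^bsub>T_star_R2 S\<^esub> y) \<cdot>\<^bsub>T_star_R2 S\<^esub> z = x \<cdot>\<^bsub>T_star_R2 S\<^esub> (y \<cdot>\<^bsub>T_star_R2 S\<^esub> z)"
proof -
  interpret sgp S by fact
  obtain s t a s' t' b where "x = (s, t, a)" "y = (s', t', b)"
    by (metis prod_cases3)
  moreover obtain s'' t'' c where "z = (s'', t'', c)"
    by (metis prod_cases3)
  ultimately show ?thesis
    using assms by (cases a; cases b; cases c) (simp_all add: mul_T_star_R2 assoc)
qed

section \<open>The elements of \<open>T(S)\<close>\<close>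

locale covered_sgp = sgp S for S :: "'a sgp" (structure) +
  assumes covered: "s \<in> carrier S \<Longrightarrow> \<exists>e \<in> idem S. \<exists>f \<in> idem S. s \<cdot> e = s \<and> f \<cdot> s = s"
begin

text \<open>
  A left idempotent cover \<open>f t = t\<close> makes \<open>t\<close> itself a left multiple, so that the adjoined identity
  contributes nothing.
\<close>

lemma left_multiples1_eq:
  assumes "t \<in> carrier S"
  shows "left_multiples1 S t = {x \<cdot> t | x. x \<in> carrier S}"
proof -
  obtain f where "f \<in> carrier S" "f \<cdot> t = t"
    using covered[OF assms] by (auto simp: idem_def)
  then have "t \<in> {x \<cdot> t | x. x \<in> carrier S}"
    by (metis (mono_tags, lifting) mem_Collect_eq)
  then show ?thesis
    using assms closed by (auto simp: left_multiples1_def adjoin_one_def)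
qed

lemma T_idemsI_sigma:
  assumes "e \<in> idem S" "s \<in> carrier S" "s \<cdot> e = s"
  shows "(s, e, R2_sigma) \<in> T_idems S"
  using assms
  by (force simp: T_idems_def idem_def mul_T_star_R2 left_multiples1_eq)

lemma T_idemsI_tau:
  assumes "e \<in> idem S"
  shows "(e, e, R2_tau) \<in> T_idems S"
  using assms
  by (force simp: T_idems_def idem_def mul_T_star_R2 left_multiples1_eq)

text \<open>
  The triples with \<open>s \<in> S t\<close> are closed under multiplication because a factor on the right multiplies
  both components by the same element. Conversely, let \<open>t e = t = f t\<close> with
  idempotents \<open>e\<close>, \<open>f\<close>. Then
  \<open>(f, f, \<tau>) (t, e, \<sigma>) = (t, t, \<sigma>)\<close> and \<open>(t, t, \<sigma>) (e, e, \<tau>) = (t, t, \<tau>)\<close>, and multiplication by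
  \<open>(x f, f, \<sigma>)\<close> on the left turns \<open>(t, t, \<alpha>)\<close> into \<open>(x t, t, \<alpha>)\<close>.
\<close>

lemma carrier_T: "carrier (T_sgp S) = {(x \<cdot> t, t, a) | x t a. x \<in> carrier S \<and> t \<in> carrier S}"
  (is "_ = ?R")
proof
  show "carrier (T_sgp S) \<subseteq> ?R"
  proof
    fix w assume "w \<in> carrier (T_sgp S)"
    then have "w \<in> sgp_gen (T_star_R2 S) (T_idems S)"
      by (simp add: T_sgp_def)
    then show "w \<in> ?R"
    proof induction
      case (base w)
      then show ?case
        by (auto simp: T_idems_def idem_def left_multiples1_eq)
    next
      case (mult w1 w2)
      then obtain x1 t1 a1 x2 t2 a2 where w: "w1 = (x1 \<cdot> t1, t1, a1)" "w2 = (x2 \<cdot> t2, t2, a2)"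
        and mem: "x1 \<in> carrier S" "t1 \<in> carrier S" "x2 \<in> carrier S" "t2 \<in> carrier S"
        by auto
      have r: "entry a1 w2 \<in> carrier S"
        using mem w closed by (auto intro: entry_in_carrier)
      have "w1 \<cdot>\<^bsub>T_star_R2 S\<^esub> w2 = (x1 \<cdot> (t1 \<cdot> entry a1 w2), t1 \<cdot> entry a1 w2, a2)"
        using mem r assoc w by (simp add: mul_T_star_R2)
      then show ?case
        using mem r closed by blast
    qed
  qed
next
  show "?R \<subseteq> carrier (T_sgp S)"
  proof
    fix w assume "w \<in> ?R"
    then obtain x t a where w: "w = (x \<cdot> t, t, a)" and mem: "x \<in> carrier S" "t \<in> carrier S"
      by blast
    let ?G = "sgp_gen (T_star_R2 S) (T_idems S)"
    obtain e f where e: "e \<in> idem S" "t \<cdot> e = t" and f: "f \<in> idem S" "f \<cdot> t = t"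
      using covered[OF mem(2)] by blast
    have ef: "e \<in> carrier S" "f \<in> carrier S" "f \<cdot> f = f"
      using e f by (auto simp: idem_def)
    have "(f, f, R2_tau) \<cdot>\<^bsub>T_star_R2 S\<^esub> (t, e, R2_sigma) \<in> ?G"
      using e f mem by (intro sgp_gen.intros T_idemsI_tau T_idemsI_sigma)
    then have diag_sigma: "(t, t, R2_sigma) \<in> ?G"
      using f by (simp add: mul_T_star_R2)
    have "(t, t, R2_sigma) \<cdot>\<^bsub>T_star_R2 S\<^esub> (e, e, R2_tau) \<in> ?G"
      using diag_sigma e by (intro sgp_gen.mult) (auto intro: sgp_gen.base T_idemsI_tau)
    then have "(t, t, R2_tau) \<in> ?G"
      using e by (simp add: mul_T_star_R2)
    with diag_sigma have diag: "(t, t, a) \<in> ?G"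
      by (cases a) simp_all
    have "(x \<cdot> f, f, R2_sigma) \<in> T_idems S"
      using f ef mem closed assoc by (intro T_idemsI_sigma) simp_all
    then have "(x \<cdot> f, f, R2_sigma) \<cdot>\<^bsub>T_star_R2 S\<^esub> (t, t, a) \<in> ?G"
      using diag by (blast intro: sgp_gen.intros)
    then show "w \<in> carrier (T_sgp S)"
      using f ef mem assoc w by (simp add: mul_T_star_R2 T_sgp_def)
  qed
qed

lemma diagonal_in_T: "t \<in> carrier S \<Longrightarrow> (t, t, a) \<in> carrier (T_sgp S)"
  using covered[of t] by (force simp: carrier_T idem_def)

lemma T_subset_T_star_R2: "carrier (T_sgp S) \<subseteq> carrier (T_star_R2 S)"
  using closed by (auto simp: carrier_T)

lemma entry_T_in_carrier: "x \<in> carrier (T_sgp S) \<Longrightarrow> entry a x \<in> carrier S"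
  using closed by (auto simp: carrier_T intro: entry_in_carrier)

lemma sgp_T: "sgp (T_sgp S)"
proof
  show "carrier (T_sgp S) \<noteq> {}"
    using nonempty diagonal_in_T by blast
  show "x \<cdot>\<^bsub>T_sgp S\<^esub> y \<in> carrier (T_sgp S)"
    if "x \<in> carrier (T_sgp S)" "y \<in> carrier (T_sgp S)" for x y
    using that by (auto simp: T_sgp_def intro: sgp_gen.mult)
  show "(x \<cdot>\<^bsub>T_sgp S\<^esub> y) \<cdot>\<^bsub>T_sgp S\<^esub> z = x \<cdot>\<^bsub>T_sgp S\<^esub> (y \<cdot>\<^bsub>T_sgp S\<^esub> z)"
    if "x \<in> carrier (T_sgp S)" "y \<in> carrier (T_sgp S)" "z \<in> carrier (T_sgp S)" for x y z
    using that[THEN subsetD[OF T_subset_T_star_R2]] T_star_R2_assoc[OF sgp_axioms] by simp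
qed

section \<open>Regularity\<close>

text \<open>
  If \<open>t y t = t\<close>, then also \<open>s y t = s\<close> for every \<open>s \<in> S t\<close>, and so \<open>(y, y, \<sigma>)\<close> serves \<open>(s, t, \<alpha>)\<close>. In
  the other direction, whatever serves \<open>(t, t, \<sigma>)\<close> has second component \<open>y\<close> with \<open>t y t = t\<close>.
\<close>

lemma regular_T_iff: "regular_sgp (T_sgp S) \<longleftrightarrow> regular_sgp S"
proof
  assume "regular_sgp S"
  then interpret R: regular_sgp S .
  show "regular_sgp (T_sgp S)"
  proof (intro regular_sgp.intro sgp_T regular_sgp_axioms.intro)
    fix w assume "w \<in> carrier (T_sgp S)"
    then obtain x t a where w: "w = (x \<cdot> t, t, a)" and mem: "x \<in> carrier S" "t \<in> carrier S"
      by (auto simp: carrier_T)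
    obtain y where y: "y \<in> carrier S" "t \<cdot> y \<cdot> t = t"
      using R.regular mem by blast
    then have "x \<cdot> t \<cdot> y \<cdot> t = x \<cdot> t"
      using mem closed assoc by metis
    then have "w \<cdot>\<^bsub>T_sgp S\<^esub> (y, y, R2_sigma) \<cdot>\<^bsub>T_sgp S\<^esub> w = w"
      using y by (cases a) (simp_all add: w mul_T_star_R2)
    then show "\<exists>z\<in>carrier (T_sgp S). w \<cdot>\<^bsub>T_sgp S\<^esub> z \<cdot>\<^bsub>T_sgp S\<^esub> w = w"
      using diagonal_in_T y by blast
  qed
next
  assume "regular_sgp (T_sgp S)"
  then interpret R: regular_sgp "T_sgp S" .
  show "regular_sgp S"
  proof (intro regular_sgp.intro sgp_axioms regular_sgp_axioms.intro)
    fix t assume t: "t \<in> carrier S"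
    obtain z where z: "z \<in> carrier (T_sgp S)"
      and eq: "(t, t, R2_sigma) \<cdot>\<^bsub>T_sgp S\<^esub> z \<cdot>\<^bsub>T_sgp S\<^esub> (t, t, R2_sigma) = (t, t, R2_sigma)"
      using R.regular[OF diagonal_in_T[OF t]] by blast
    from eq have "t \<cdot> entry R2_sigma z \<cdot> t = t"
      by (cases "snd (snd z)") (simp_all add: mul_T_star_R2)
    then show "\<exists>y\<in>carrier S. t \<cdot> y \<cdot> t = t"
      using z entry_T_in_carrier by blast
  qed
qed

section \<open>Local submonoids\<close>

lemma mem_local_submonoid_iff:
  assumes "e \<in> idem S"
  shows "u \<in> carrier (local_submonoid S e) \<longleftrightarrow> u \<in> carrier S \<and> e \<cdot> u = u \<and> u \<cdot> e = u"
proof -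
  have e: "e \<in> carrier S" "e \<cdot> e = e"
    using assms by (auto simp: idem_def)
  show ?thesis
  proof
    assume "u \<in> carrier (local_submonoid S e)"
    then obtain a where a: "a \<in> carrier S" "u = e \<cdot> a \<cdot> e"
      by (auto simp: local_submonoid_def)
    have "e \<cdot> (e \<cdot> a \<cdot> e) = e \<cdot> e \<cdot> a \<cdot> e" "e \<cdot> a \<cdot> e \<cdot> e = e \<cdot> a \<cdot> (e \<cdot> e)"
      using e(1) a(1) closed by (simp_all add: assoc)
    with a e closed show "u \<in> carrier S \<and> e \<cdot> u = u \<and> u \<cdot> e = u"
      by simp
  next
    assume "u \<in> carrier S \<and> e \<cdot> u = u \<and> u \<cdot> e = u"
    then show "u \<in> carrier (local_submonoid S e)"
      by (force simp: local_submonoid_def)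
  qed
qed

lemma local_submonoid_closed:
  assumes e: "e \<in> idem S"
    and "u \<in> carrier (local_submonoid S e)" "v \<in> carrier (local_submonoid S e)"
  shows "u \<cdot>\<^bsub>local_submonoid S e\<^esub> v \<in> carrier (local_submonoid S e)"
proof -
  have mem: "u \<in> carrier S" "v \<in> carrier S" "e \<cdot> u = u" "v \<cdot> e = v" "e \<in> carrier S"
    using assms mem_local_submonoid_iff[OF e] by (auto simp: idem_def)
  then have "e \<cdot> (u \<cdot> v) = u \<cdot> v" "u \<cdot> v \<cdot> e = u \<cdot> v"
    using assoc by metis+
  then have "u \<cdot> v \<in> carrier (local_submonoid S e)"
    using mem closed by (simp add: mem_local_submonoid_iff[OF e])
  then show ?thesis
    by (simp add: local_submonoid_def)
qed

lemma entry_idem_T: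
  assumes "(s, t, a) \<in> idem (T_sgp S)"
  defines "e \<equiv> entry a (s, t, a)"
  shows "e \<in> idem S" "s \<cdot> e = s" "t \<cdot> e = t"
proof -
  show se: "s \<cdot> e = s" and te: "t \<cdot> e = t"
    using assms by (auto simp: idem_def mul_T_star_R2)
  have "e \<cdot> e = e"
    using se te unfolding e_def by (cases a) simp_all
  then show "e \<in> idem S"
    using assms entry_T_in_carrier by (simp add: idem_def)
qed

text \<open>
  Multiplicativity and injectivity both hold because the \<open>\<alpha>\<close>-entry of \<open>(s u, t u, \<alpha>)\<close> is \<open>e u = u\<close>.
  For surjectivity, \<open>g x g = (s w, t w, \<alpha>)\<close> with \<open>w = entry \<alpha> x \<cdot> entry \<beta> g\<close>, where \<open>\<beta>\<close> is the last
  component of \<open>x\<close>. Here \<open>w e = w\<close>, since \<open>s e = s\<close> and \<open>t e = t\<close>, and \<open>w\<close> may be replaced by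
  \<open>e w \<in> e S e\<close> for the same reason.
\<close>

lemma local_submonoid_T_isomorphic:
  assumes g: "(s, t, a) \<in> idem (T_sgp S)"
  shows "sgp_isomorphic (local_submonoid S (entry a (s, t, a))) (local_submonoid (T_sgp S) (s, t, a))"
proof -
  define e where "e = entry a (s, t, a)"
  let ?g = "(s, t, a)"
  let ?A = "local_submonoid S e" and ?B = "local_submonoid (T_sgp S) ?g"
  let ?h = "\<lambda>u. (s \<cdot> u, t \<cdot> u, a)"
  note idem_e = entry_idem_T[OF g, folded e_def]
  note mem_A = mem_local_submonoid_iff[OF idem_e(1)]
  have gT: "?g \<in> carrier (T_sgp S)"
    using g by (simp add: idem_def)
  then obtain x where x: "x \<in> carrier S" "s = x \<cdot> t" and t: "t \<in> carrier S"
    by (auto simp: carrier_T)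
  have s: "s \<in> carrier S" and e: "e \<in> carrier S"
    using x t closed idem_e(1) by (auto simp: idem_def)
  have entry_h: "entry a (?h u) = u" if "u \<in> carrier ?A" for u
    using that mem_A entry_mul[where S = S and a = a and b = a and c = a] by (simp add: e_def)
  have B_def: "carrier ?B = {?g \<cdot>\<^bsub>T_sgp S\<^esub> y \<cdot>\<^bsub>T_sgp S\<^esub> ?g | y. y \<in> carrier (T_sgp S)}"
    by (simp add: local_submonoid_def)
  have h_in: "?h u \<in> carrier ?B" if u: "u \<in> carrier ?A" for u
  proof -
    have u': "u \<in> carrier S" "u \<cdot> e = u"
      using u mem_A by auto
    then have "?h u \<in> carrier (T_sgp S)"
      using x t closed assoc by (auto simp: carrier_T)
    moreover have "s \<cdot> u \<cdot> e = s \<cdot> u" "t \<cdot> u \<cdot> e = t \<cdot> u"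
      using u' s t e by (simp_all add: assoc)
    then have "?g \<cdot>\<^bsub>T_sgp S\<^esub> ?h u \<cdot>\<^bsub>T_sgp S\<^esub> ?g = ?h u"
      using entry_h[OF u] by (simp add: mul_T_star_R2 flip: e_def)
    ultimately show ?thesis
      unfolding B_def by (metis (mono_tags, lifting) mem_Collect_eq)
  qed
  have surj: "\<exists>u \<in> carrier ?A. y = ?h u" if y: "y \<in> carrier ?B" for y
  proof -
    obtain z where z: "z \<in> carrier (T_sgp S)" "y = ?g \<cdot>\<^bsub>T_sgp S\<^esub> z \<cdot>\<^bsub>T_sgp S\<^esub> ?g"
      using y unfolding B_def by blast
    define r q where "r = entry a z" and "q = entry (snd (snd z)) ?g"
    have rq: "r \<in> carrier S" "q \<in> carrier S"
      unfolding r_def q_def using z gT entry_T_in_carrier by blast+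
    have "q \<cdot> e = q"
      unfolding q_def using idem_e by (cases "snd (snd z)") simp_all
    then have "e \<cdot> (r \<cdot> q) \<in> carrier ?A"
      using rq e idem_e(1) closed unfolding mem_A by (simp add: idem_def flip: assoc) (simp add: assoc)
    moreover have "v \<cdot> r \<cdot> q = v \<cdot> (e \<cdot> (r \<cdot> q))" if "v \<cdot> e = v" "v \<in> carrier S" for v
      using that rq e closed by (metis assoc)
    then have "y = ?h (e \<cdot> (r \<cdot> q))"
      using z(2) s t idem_e by (simp add: mul_T_star_R2 flip: r_def q_def)
    ultimately show ?thesis
      by blast
  qed
  have "?h (u \<cdot> v) = ?h u \<cdot>\<^bsub>T_star_R2 S\<^esub> ?h v" if "u \<in> carrier ?A" "v \<in> carrier ?A" for u v
    using that entry_h[OF that(2)] s t mem_A by (simp add: mul_T_star_R2 assoc)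
  then have "?h \<in> sgp_hom ?A ?B"
    using h_in by (auto simp: sgp_hom_def local_submonoid_def)
  moreover have "bij_betw ?h (carrier ?A) (carrier ?B)"
    unfolding bij_betw_def
  proof
    show "inj_on ?h (carrier ?A)"
      using entry_h by (rule inj_on_inverseI)
    show "?h ` carrier ?A = carrier ?B"
      using h_in surj by blast
  qed
  ultimately show ?thesis
    unfolding sgp_isomorphic_def e_def by blast
qed

section \<open>Membership in \<open>LV\<close>\<close>

lemma in_class_local_submonoid_T:
  assumes "(s, t, a) \<in> idem (T_sgp S)"
  shows "in_class (local_submonoid (T_sgp S) (s, t, a)) V
    \<longleftrightarrow> in_class (local_submonoid S (entry a (s, t, a))) V"
  using in_class_isomorphic[OF local_submonoid_T_isomorphic[OF assms]]
    local_submonoid_closed[OF entry_idem_T(1)[OF assms]] by blast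

lemma LV_T_iff: "S \<in> LV V \<longleftrightarrow> T_sgp S \<in> LV V"
proof -
  have "(\<forall>e \<in> idem S. in_class (local_submonoid S e) V)
    \<longleftrightarrow> (\<forall>g \<in> idem (T_sgp S). in_class (local_submonoid (T_sgp S) g) V)"
  proof
    assume "\<forall>e \<in> idem S. in_class (local_submonoid S e) V"
    then show "\<forall>g \<in> idem (T_sgp S). in_class (local_submonoid (T_sgp S) g) V"
      using entry_idem_T(1) in_class_local_submonoid_T by fast
  next
    assume R: "\<forall>g \<in> idem (T_sgp S). in_class (local_submonoid (T_sgp S) g) V"
    show "\<forall>e \<in> idem S. in_class (local_submonoid S e) V"
    proof
      fix e assume "e \<in> idem S"
      then have "(e, e, R2_sigma) \<in> idem (T_sgp S)"
        using diagonal_in_T by (simp add: idem_def mul_T_star_R2)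
      then show "in_class (local_submonoid S e) V"
        using R in_class_local_submonoid_T by fastforce
    qed
  qed
  then show ?thesis
    by (simp add: LV_def regular_T_iff)
qed

end

theorem corollary4p7:
  fixes V :: "('u::infinite) sgp set" and S :: "'u sgp"
  assumes "e_variety V"
    and "idempotent_covered S"
  shows "S \<in> LV V \<longleftrightarrow> T_sgp S \<in> LV V"
proof -
  have "covered_sgp S"
    using assms(2) by (simp add: idempotent_covered_def covered_sgp_def covered_sgp_axioms_def)
  then show ?thesis
    by (rule covered_sgp.LV_T_iff)
qed

end
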